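(* Let $n\ge 1$ and let $T$ be a rationalizable data set over an $n\times n$ strategy space in which every observation is of the form $((i,j),[n],[n])$ (with $(i,j)\in[n]\times[n]$). Then there exists an $n\times n$ bimatrix game $(A,B)$ with $\operatorname{rank}(A+B)=1$ that rationalizes $T$.
   Context: Write $[n]=\{1,\dots,n\}$. An $n\times n$ bimatrix game is a pair $(A,B)$ of real $n\times n$ matrices: $A$ is the payoff matrix of the row player and $B$ that of the column player. The rank of the game is the rank of the matrix $A+B$. A subgame is a pair $(I,J)$ with $I,J\subseteq[n]$. A data set $T$ (over an $n\times n$ strategy space) is a set of triples $((i,j),I,J)$, called observations, where $(I,J)$ is a subgame, $i\in I$ and $j\in J$. A profile $(i,j)\in I\times J$ is a strict (pure) Nash equilibrium of the subgame $(I,J)$ of $(A,B)$ if $A_{ij}>A_{i'j}$ for all $i'\in I\setminus\{i\}$ and $B_{ij}>B_{ij'}$ for all $j'\in J\setminus\{j\}$. The game $(A,B)$ rationalizes $T$ if for every $((i,j),I,J)\in T$ the profile $(i,j)$ is a strict Nash equilibrium of the subgame $(I,J)$. $T$ is rationalizable if some bimatrix game rationalizes it. *)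

theory Defs
  imports "HOL-Analysis.Analysis"
begin

(* The n strategies of each player are the elements of a finite type 'n with n = CARD('n) >= 1,
   so that [n] is UNIV. The first index of a payoff matrix is the row player's strategy. *)

type_synonym 'n bimatrix_game = "(real^'n^'n) \<times> (real^'n^'n)"

type_synonym 'n subgame = "'n set \<times> 'n set"

type_synonym 'n observation = "('n \<times> 'n) \<times> 'n subgame"

definition game_rank :: "'n::finite bimatrix_game \<Rightarrow> nat" where
  "game_rank = (\<lambda>(A, B). rank (A + B))"

definition data_set :: "'n observation set \<Rightarrow> bool" where
  "data_set T \<longleftrightarrow> (\<forall>((i, j), (I, J)) \<in> T. i \<in> I \<and> j \<in> J)"

definition strict_nash :: "'n::finite bimatrix_game \<Rightarrow> 'n subgame \<Rightarrow> 'n \<times> 'n \<Rightarrow> bool" where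
  "strict_nash = (\<lambda>(A, B) (I, J) (i, j).
     i \<in> I \<and> j \<in> J \<and>
     (\<forall>i' \<in> I - {i}. A $ i $ j > A $ i' $ j) \<and>
     (\<forall>j' \<in> J - {j}. B $ i $ j > B $ i $ j'))"

definition rationalizes :: "'n::finite bimatrix_game \<Rightarrow> 'n observation set \<Rightarrow> bool" where
  "rationalizes G T \<longleftrightarrow> (\<forall>(p, S) \<in> T. strict_nash G S p)"

definition rationalizable :: "'n::finite observation set \<Rightarrow> bool" where
  "rationalizable T \<longleftrightarrow> (\<exists>G. rationalizes G T)"

end

theory Submission
  imports Defs
begin

text \<open>Only the set of observed profiles matters, and rationalizability makes it a partial matching
  between rows and columns. Give the rows distinct positive numbers \<open>x\<^sub>i\<close>, and let column \<open>j\<close> have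
  \<open>y\<^sub>j = x\<^sub>i\<close> if it is matched to row \<open>i\<close>, and a positive value different from all \<open>x\<^sub>i\<close> otherwise. The
  payoffs \<open>A\<^sub>i\<^sub>j = x\<^sub>i y\<^sub>j - x\<^sub>i\<^sup>2 / 2\<close> are maximized in column \<open>j\<close> exactly where \<open>x\<^sub>i = y\<^sub>j\<close>.
  Setting \<open>B\<^sub>i\<^sub>j = - A\<^sub>i\<^sub>j - x\<^sub>i\<^sup>3 / y\<^sub>j\<close>, the dependence on \<open>j\<close> is \<open>- x\<^sub>i (y\<^sub>j + x\<^sub>i\<^sup>2 / y\<^sub>j)\<close>, which by
  AM-GM is maximized exactly where \<open>y\<^sub>j = x\<^sub>i\<close>; and \<open>A + B\<close> is an outer product.\<close>

text \<open>Every row is a multiple of \<open>v\<close>, and a nonzero entry of \<open>u\<close>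
  gives a nonzero multiple, so the row space is the line through \<open>v\<close>.\<close>

lemma rank_outer_product:
  fixes u :: "real^'m" and v :: "real^'n"
  assumes "u \<noteq> 0" "v \<noteq> 0"
  shows "rank (\<chi> i j. u $ i * v $ j) = 1"
proof -
  let ?M = "(\<chi> i j. u $ i * v $ j) :: real^'n^'m"
  have row: "row i ?M = u $ i *\<^sub>R v" for i
    by (simp add: row_def vec_eq_iff)
  obtain k where k: "u $ k \<noteq> 0"
    using assms(1) by (auto simp: vec_eq_iff)
  have "r \<in> span {v}" if r: "r \<in> rows ?M" for r
  proof -
    obtain i where "r = u $ i *\<^sub>R v"
      using r unfolding rows_def row by blast
    then show ?thesis
      by (simp add: span_mul span_base)
  qed
  then have "rows ?M \<subseteq> span {v}"
    by blast
  moreover have "v \<in> span (rows ?M)"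
  proof -
    have "(1 / u $ k) *\<^sub>R row k ?M \<in> span (rows ?M)"
      by (intro span_mul span_base) (auto simp: rows_def)
    then show ?thesis
      using k by (simp add: row)
  qed
  ultimately have "span (rows ?M) = span {v}"
    by (simp add: span_eq)
  then have "dim (rows ?M) = dim {v}"
    by (metis dim_span)
  also have "\<dots> = 1"
    using assms(2) by (simp add: dim_insert)
  finally show ?thesis
    by (simp add: row_rank_def)
qed

text \<open>The right side exceeds the left by \<open>(s - t)\<^sup>2 / 2\<close>.\<close>

lemma quadratic_payoff_less:
  fixes s t :: real
  assumes "s \<noteq> t"
  shows "s * t - s\<^sup>2 / 2 < t * t - t\<^sup>2 / 2"
proof -
  have "0 < (s - t)\<^sup>2"
    using assms by simp
  then show ?thesis
    by (simp add: power2_eq_square algebra_simps)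
qed

lemma reciprocal_payoff_less:
  fixes s t :: real
  assumes "s > 0" "t > 0" "t \<noteq> s"
  shows "- (s * t) - s ^ 3 / t < - (s * s) - s ^ 3 / s"
proof -
  have "s * t + s ^ 3 / t - (s * s + s ^ 3 / s) = s * (s - t)\<^sup>2 / t"
    using assms by (simp add: field_simps power2_eq_square power3_eq_cube)
  moreover have "s * (s - t)\<^sup>2 / t > 0"
    using assms by simp
  ultimately show ?thesis
    by linarith
qed

theorem theorem2:
  fixes T :: "'n::finite observation set"
  assumes "data_set T"
    and "rationalizable T"
    and "\<forall>(p, S) \<in> T. S = (UNIV, UNIV)"
  shows "\<exists>A B :: real^'n^'n. game_rank (A, B) = 1 \<and> rationalizes (A, B) T"
proof -
  define E where "E = fst ` T"
  obtain A0 B0 where G: "rationalizes (A0, B0) T"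
    using assms(2) by (auto simp: rationalizable_def)
  have full: "strict_nash (A0, B0) (UNIV, UNIV) p" if p: "p \<in> E" for p
  proof -
    obtain S where "(p, S) \<in> T"
      using p by (force simp: E_def)
    then show ?thesis
      using G assms(3) by (auto simp: rationalizes_def)
  qed
  \<comment> \<open>Two distinct observed rows in one column would each be strictly better than the
    other.\<close>
  have row_unique: "i = i'" if "(i, j) \<in> E" "(i', j) \<in> E" for i i' j
  proof (rule ccontr)
    assume "i \<noteq> i'"
    then have "A0 $ i $ j < A0 $ i' $ j" "A0 $ i' $ j < A0 $ i $ j"
      using full[OF that(1)] full[OF that(2)] by (simp_all add: strict_nash_def)
    then show False
      by simp
  qed
  have col_unique: "j = j'" if "(i, j) \<in> E" "(i, j') \<in> E" for i j j'
  proof (rule ccontr)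
    assume "j \<noteq> j'"
    then have "B0 $ i $ j < B0 $ i $ j'" "B0 $ i $ j' < B0 $ i $ j"
      using full[OF that(1)] full[OF that(2)] by (simp_all add: strict_nash_def)
    then show False
      by simp
  qed
  obtain f :: "'n \<Rightarrow> nat" where f: "inj f"
    using finite_imp_inj_to_nat_seg[of "UNIV :: 'n set"] by auto
  define x where "x = (\<lambda>i. real (f i) + 1)"
  \<comment> \<open>The default \<open>1 / 2\<close> is positive and, since every \<open>x i\<close>
    is at least 1, never equal to a row value.\<close>
  define y where "y = (\<lambda>j. if \<exists>i. (i, j) \<in> E then x (THE i. (i, j) \<in> E) else 1 / 2)"
  have x_pos: "x i > 0" for i
    by (simp add: x_def add_pos_pos)
  then have x_nz: "x i \<noteq> 0" for i
    by (metis less_irrefl)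
  have x_inj: "x i = x i' \<longleftrightarrow> i = i'" for i i'
    using f by (auto simp: x_def inj_def)
  have y_matched: "y j = x i" if "(i, j) \<in> E" for i j
  proof -
    have "(THE i. (i, j) \<in> E) = i"
      using that row_unique by blast
    then show ?thesis
      using that by (auto simp: y_def)
  qed
  have y_pos: "y j > 0" for j
    using x_pos by (simp add: y_def)
  then have y_nz: "y j \<noteq> 0" for j
    by (metis less_irrefl)
  have y_eq: "(i, j) \<in> E" if "y j = x i" for i j
  proof (cases "\<exists>i'. (i', j) \<in> E")
    case True
    then obtain i' where i': "(i', j) \<in> E"
      by blast
    then have "i' = i"
      using that y_matched[OF i'] by (simp add: x_inj)
    then show ?thesis
      using i' by simp
  next
    case False
    then show ?thesis
      using that by (simp add: y_def x_def)
  qed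
  define A :: "real^'n^'n" where "A = (\<chi> i j. x i * y j - (x i)\<^sup>2 / 2)"
  \<comment> \<open>The first summand cancels against \<open>A\<close> in the sum and is constant
    along each row, so it leaves the column player's comparisons unchanged.\<close>
  define B :: "real^'n^'n" where "B = (\<chi> i j. (x i)\<^sup>2 / 2 + (- (x i * y j) - x i ^ 3 / y j))"
  define u :: "real^'n" where "u = (\<chi> i. - (x i ^ 3))"
  define v :: "real^'n" where "v = (\<chi> j. 1 / y j)"
  have nash: "strict_nash (A, B) (UNIV, UNIV) (i, j)" if ij: "(i, j) \<in> E" for i j
  proof -
    have "A $ i' $ j < A $ i $ j" if "i' \<noteq> i" for i'
      using quadratic_payoff_less[of "x i'" "x i"] that
      by (simp add: A_def y_matched[OF ij] x_inj)
    moreover have "B $ i $ j' < B $ i $ j" if "j' \<noteq> j" for j'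
    proof -
      \<comment> \<open>Equality would make row \<open>i\<close> matched to both \<open>j\<close>
        and \<open>j'\<close>.\<close>
      have "y j' \<noteq> x i"
        using y_eq col_unique ij that by blast
      then show ?thesis
        using reciprocal_payoff_less[OF x_pos y_pos, of j' i]
        by (simp add: B_def y_matched[OF ij])
    qed
    ultimately show ?thesis
      by (simp add: strict_nash_def)
  qed
  have "A + B = (\<chi> i j. u $ i * v $ j)"
    by (simp add: A_def B_def u_def v_def vec_eq_iff)
  moreover have "u \<noteq> 0" "v \<noteq> 0"
    by (simp_all add: u_def v_def vec_eq_iff x_nz y_nz)
  ultimately have "game_rank (A, B) = 1"
    by (simp add: game_rank_def rank_outer_product)
  moreover have "rationalizes (A, B) T"
    unfolding rationalizes_def
  proof (intro ballI, clarify)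
    fix i j I J
    assume obs: "((i, j), I, J) \<in> T"
    then have "(i, j) \<in> E"
      by (force simp: E_def)
    moreover have "(I, J) = (UNIV, UNIV)"
      using obs assms(3) by blast
    ultimately show "strict_nash (A, B) (I, J) (i, j)"
      using nash by simp
  qed
  ultimately show ?thesis
    by blast
qed

end
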